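(* As formal power series in $q$ (equivalently, for complex $q$ with $|q|<1$), $$\sum_{n\ge 0}\frac{q^{n^2+2n}}{(q;q)_{2n+1}}=\frac{1}{(q;q)_\infty}\sum_{k\in\mathbb{Z}}\left(q^{15k^2-7k}-q^{15k^2+13k+2}\right).$$
   Context: $(q;q)_n=\prod_{j=1}^{n}(1-q^j)$ and $(q;q)_\infty=\prod_{j\ge1}(1-q^j)$. *)

theory Defs
  imports "HOL-Analysis.Analysis" "HOL-Computational_Algebra.Formal_Power_Series"
begin

text \<open>
  Both symbols \<open>(q;q)\<^sub>n\<close> and \<open>(q;q)\<^sub>\<infinity>\<close> are polymorphic, so that \<open>q\<close> may be a complex number or the
  formal variable \<^term>\<open>fps_X\<close>. On formal power series, limits (hence infinite sums and products)
  refer to the library's \<open>X\<close>-adic metric.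
\<close>

definition qfact :: "'a::comm_ring_1 \<Rightarrow> nat \<Rightarrow> 'a" where
  "qfact q n = (\<Prod>j=1..n. 1 - q ^ j)"

text \<open>The index of \<^const>\<open>prodinf\<close> starts at \<open>0\<close>, hence the shift.\<close>

definition qfact_inf :: "'a::{t2_space, comm_ring_1} \<Rightarrow> 'a" where
  "qfact_inf q = (\<Prod>j. 1 - q ^ Suc j)"

text \<open>
  The exponents below are nonnegative for every integer \<open>k\<close>, so \<open>powi\<close> with these exponents is an
  ordinary power; no inverse of \<open>q\<close> is involved (which matters for \<open>q = 0\<close> and \<open>q = fps_X\<close>).
\<close>

lemma exponent1_nonneg: "15 * k\<^sup>2 - 7 * k \<ge> 0" for k :: int
proof -
  have "k * 1 \<le> k * k"
  proof (cases "k \<ge> 1")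
    case True
    then show ?thesis by (intro mult_left_mono) auto
  next
    case False
    then show ?thesis using zero_le_square[of k] by linarith
  qed
  then show ?thesis
    using zero_le_square[of k] unfolding power2_eq_square by linarith
qed

lemma exponent2_nonneg: "15 * k\<^sup>2 + 13 * k + 2 \<ge> 0" for k :: int
proof -
  have "(- k) * 1 \<le> (- k) * (- k)"
  proof (cases "- k \<ge> 1")
    case True
    then show ?thesis by (intro mult_left_mono) auto
  next
    case False
    then have "(- k) * 1 \<le> 0" by simp
    also have "0 \<le> (- k) * (- k)" by simp
    finally show ?thesis .
  qed
  then have "- k \<le> k * k" by simp
  then show ?thesis
    using zero_le_square[of k] unfolding power2_eq_square by linarith
qed

end

theory Submission
  imports Defs
begin

text \<open>
  The sequence \<open>q\<^sup>n / (q;q)\<^bsub>2n+1\<^esub>\<close> is, up to a factor \<open>1 - q\<close>, the \<open>\<beta>\<close>-part of Slater's Bailey pair A(4), that is,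
  \<open>\<Sum>\<^sub>r q\<^bsup>6r^2+4r\<^esup> ([2n+1, n-3r] - [2n+1, n-3r-1]) = q\<^sup>n\<close> in terms of \<open>q\<close>-binomial coefficients.
  Applying the \<open>q\<close>-Pascal rules twice to the companion sum for \<open>1 = \<Sum>\<^sub>r q\<^bsup>6r^2+r\<^esup> [2n, n-3r] - \<dots>\<close>
  lowers \<open>n\<close> by one, because the correction terms cancel under \<open>r \<mapsto> -r\<close> and \<open>r \<mapsto> -1-r\<close>; one
  more step gives A(4). Multiplying by \<open>q\<^bsup>n^2+n\<^esup> / (q;q)\<^bsub>N-n\<^esub>\<close> and summing over \<open>n \<le> N\<close>, the
  \<open>q\<close>-Vandermonde sum evaluates the inner sums. This yields an identity between finite sums, valid in
  every commutative ring in which all \<open>(q;q)\<^sub>n\<close> are invertible, and \<open>N \<rightarrow> \<infinity>\<close> is taken separately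
  for complex numbers (Tannery's theorem) and for formal power series (coefficientwise).
\<close>

section \<open>Powers with integer exponents and inverse q-factorials\<close>

text \<open>The exponents are polynomials in an integer \<open>r\<close>, hence of type
  \<open>int\<close>. A negative exponent is truncated to 0; where one can occur, it is accompanied
  by a vanishing factor \<open>W\<close>.\<close>

definition qpow :: "'a::comm_ring_1 \<Rightarrow> int \<Rightarrow> 'a" where
  "qpow q e = q ^ nat e"

lemma qpow_add: "a \<ge> 0 \<Longrightarrow> b \<ge> 0 \<Longrightarrow> qpow q a * qpow q b = qpow q (a + b)"
  by (simp add: qpow_def nat_add_distrib power_add)

lemma qpow_of_nat [simp]: "qpow q (int n) = q ^ n"
  by (simp add: qpow_def)

lemma qfact_Suc: "qfact q (Suc n) = (1 - q ^ Suc n) * qfact q n"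
  by (simp add: qfact_def mult.commute)

text \<open>Keeping the inverses \<open>w n\<close> of \<open>qfact q n\<close> abstract makes
  complex numbers and formal power series two instances of one algebraic argument.\<close>

locale qfact_inverse =
  fixes q :: "'a::comm_ring_1" and w :: "nat \<Rightarrow> 'a"
  assumes w_qfact: "w n * qfact q n = 1"
begin

lemma w_Suc: "w n = (1 - q ^ Suc n) * w (Suc n)"
proof -
  have "w n = w n * (w (Suc n) * qfact q (Suc n))"
    by (simp add: w_qfact)
  also have "\<dots> = (w n * qfact q n) * ((1 - q ^ Suc n) * w (Suc n))"
    by (simp add: qfact_Suc algebra_simps)
  finally show ?thesis by (simp add: w_qfact)
qed

lemma w_0 [simp]: "w 0 = 1"
  using w_qfact[of 0] by (simp add: qfact_def)

text \<open>\<open>1 - q ^ n\<close> is a factor of (q;q)_n and hence a unit, so it cancels even if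
  the ring has zero divisors.\<close>

lemma cancel_one_minus_power:
  assumes "(1 - q ^ n) * x = (1 - q ^ n) * y" "n > 0"
  shows "x = y"
proof -
  obtain m where n: "n = Suc m" using assms(2) by (cases n) auto
  have unit: "w n * qfact q m * (1 - q ^ n) = 1"
    using w_qfact[of n] unfolding n qfact_Suc by (simp only: mult_ac)
  have "x = w n * qfact q m * ((1 - q ^ n) * x)"
    using unit by (simp flip: mult.assoc)
  also have "\<dots> = y"
    unfolding assms(1) using unit by (simp flip: mult.assoc)
  finally show ?thesis .
qed

text \<open>With \<open>1 / (q;q)\<^sub>k = 0\<close> for \<open>k < 0\<close>, the rule \<open>W_pred\<close> holds for all integers \<open>k\<close>.\<close>

definition W :: "int \<Rightarrow> 'a" where
  "W k = (if k \<ge> 0 then w (nat k) else 0)"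

lemma W_neg [simp]: "k < 0 \<Longrightarrow> W k = 0"
  by (simp add: W_def)

lemma W_of_nat [simp]: "W (int n) = w n"
  by (simp add: W_def)

lemma W_pred: "W (k - 1) = (1 - qpow q k) * W k"
proof (cases "k \<ge> 1")
  case True
  then obtain n where "k = int (Suc n)"
    by (metis Suc_diff_1 nat_0_le nat_int zero_less_imp_eq_int zless_add1_eq
        linorder_not_less not_less_iff_gr_or_eq order_less_le_trans zero_less_one)
  then show ?thesis
    using w_Suc[of n] by (simp add: W_def qpow_def nat_add_distrib)
next
  case False
  then show ?thesis by (cases "k = 0") (simp_all add: qpow_def)
qed

text \<open>The two \<open>q\<close>-Pascal rules for \<open>W a * W b = [a + b choose a]\<^sub>q / (q;q)\<^bsub>a + b\<^esub>\<close>.\<close>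

lemma pascal1:
  assumes n: "int n = a + b" and "a' = a - 1" "b' = b - 1"
  shows "(1 - q ^ n) * (W a * W b) = W a' * W b + qpow q a * (W a * W b')"
proof (cases "a \<ge> 0 \<and> b \<ge> 0")
  case True
  \<comment> \<open>Now 1 - q^n = (1 - q^a) + q^a (1 - q^b), and \<open>W_pred\<close> absorbs each
    bracket. If an index is negative, all three products vanish.\<close>
  then have "q ^ n = qpow q a * qpow q b"
    by (simp add: qpow_add flip: n)
  then show ?thesis by (simp add: assms W_pred algebra_simps)
qed (auto simp: assms not_le)

lemma pascal2:
  assumes "int n = a + b" "a' = a - 1" "b' = b - 1"
  shows "(1 - q ^ n) * (W a * W b) = W a * W b' + qpow q b * (W b * W a')"
  using pascal1[of n b a b' a'] assms by (simp add: ac_simps)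

text \<open>Exponents do not add when \<open>a\<close> is negative, because \<open>qpow\<close>
  truncates; exactly then the factor \<open>W a\<close> is zero.\<close>

lemma qpow_W_W:
  assumes "e \<ge> 0"
  shows "qpow q e * (qpow q a * (W a * b)) = qpow q (e + a) * (W a * b)"
proof (cases "a \<ge> 0")
  case True
  then show ?thesis using assms by (simp flip: qpow_add add: mult.assoc)
qed auto

section \<open>The q-Vandermonde sum\<close>

text \<open>Induction on \<open>L\<close> by the q-Pascal rule; the step passes from
  \<open>c\<close> to \<open>Suc c\<close>, so \<open>c\<close> must stay arbitrary.\<close>

lemma q_vandermonde:
  "(\<Sum>i\<le>L. q ^ (i * (i + c)) * w i * w (L - i) * w (c + i)) = w L * w (L + c)"
proof (induction L arbitrary: c)
  case 0
  then show ?case by simp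
next
  case (Suc L)
  define s where "s = (\<lambda>d. \<Sum>i\<le>L. q ^ (i * (i + d)) * w i * w (L - i) * w (d + i))"
  have s: "s d = w L * w (L + d)" for d
    using Suc.IH[of d] by (simp add: s_def)
  \<comment> \<open>Raising the last index by \<open>w_Suc\<close> produces the induction hypothesis
    at \<open>Suc c\<close>, minus a correction that cancels the other half of the Pascal split
    below.\<close>
  have low: "(\<Sum>i\<le>L. q ^ (i * (i + c) + i) * w i * w (L - i) * w (c + i)) =
      s (Suc c) - q ^ Suc c * (\<Sum>i\<le>L. q ^ (i * (i + c) + 2 * i) * w i * w (L - i) * w (Suc c + i))"
  proof -
    have "q ^ (i * (i + c) + i) * w i * w (L - i) * w (c + i) =
       q ^ (i * (i + Suc c)) * w i * w (L - i) * w (Suc c + i)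
        - q ^ Suc c * (q ^ (i * (i + c) + 2 * i) * w i * w (L - i) * w (Suc c + i))" for i
      by (subst w_Suc[of "c + i"]) (simp add: algebra_simps power_add mult_2_right)
    then show ?thesis
      by (simp add: s_def sum_subtractf sum_distrib_left)
  qed
  \<comment> \<open>The Pascal rule is applied to \<open>w i * w (Suc L - i)\<close>. Writing it
    with \<open>W\<close> avoids special cases at \<open>i = 0\<close> and \<open>i = Suc L\<close>,
    where one of the new terms contains \<open>W (- 1) = 0\<close>.\<close>
  have "(1 - q ^ Suc L) * (\<Sum>i\<le>Suc L. q ^ (i * (i + c)) * w i * w (Suc L - i) * w (c + i)) =
      (\<Sum>i\<le>Suc L. q ^ (i * (i + c)) * (W (int i - 1) * W (int (Suc L) - int i)
         + q ^ i * (W (int i) * W (int L - int i))) * w (c + i))"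
    unfolding sum_distrib_left
  proof (rule sum.cong[OF refl])
    fix i assume i: "i \<in> {..Suc L}"
    then have "w (Suc L - i) = W (int (Suc L) - int i)"
      using W_of_nat[of "Suc L - i"] by (simp add: of_nat_diff)
    moreover have "(1 - q ^ Suc L) * (W (int i) * W (int (Suc L) - int i)) =
        W (int i - 1) * W (int (Suc L) - int i) + qpow q (int i) * (W (int i) * W (int L - int i))"
      by (rule pascal1) auto
    ultimately have "(1 - q ^ Suc L) * (w i * w (Suc L - i)) =
        W (int i - 1) * W (int (Suc L) - int i) + q ^ i * (W (int i) * W (int L - int i))"
      by simp
    moreover have "(1 - q ^ Suc L) * (q ^ (i * (i + c)) * w i * w (Suc L - i) * w (c + i)) =
        q ^ (i * (i + c)) * ((1 - q ^ Suc L) * (w i * w (Suc L - i))) * w (c + i)"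
      by (simp only: mult_ac)
    ultimately show "(1 - q ^ Suc L) * (q ^ (i * (i + c)) * w i * w (Suc L - i) * w (c + i)) =
        q ^ (i * (i + c)) * (W (int i - 1) * W (int (Suc L) - int i)
         + q ^ i * (W (int i) * W (int L - int i))) * w (c + i)"
      by (simp only:)
  qed
  also have "\<dots> = (\<Sum>i\<le>Suc L. q ^ (i * (i + c)) * (W (int i - 1) * W (int (Suc L) - int i)) * w (c + i))
      + (\<Sum>i\<le>Suc L. q ^ (i * (i + c) + i) * (W (int i) * W (int L - int i)) * w (c + i))"
    by (simp add: algebra_simps power_add sum.distrib)
  \<comment> \<open>The term \<open>i = 0\<close> is zero, so the index shifts by one; the exponent
    (i+1)(i+1+c) equals i(i+c) + 2i + (c+1).\<close>
  also have "(\<Sum>i\<le>Suc L. q ^ (i * (i + c)) * (W (int i - 1) * W (int (Suc L) - int i)) * w (c + i)) =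
      (\<Sum>i\<le>L. q ^ (Suc i * (Suc i + c)) * (w i * W (int L - int i)) * w (c + Suc i))"
    by (subst sum.atMost_Suc_shift) simp
  also have "\<dots> = (\<Sum>i\<le>L. q ^ (Suc i * (Suc i + c)) * (w i * w (L - i)) * w (c + Suc i))"
    by (intro sum.cong) (auto simp: W_def nat_diff_distrib)
  also have "\<dots> = q ^ Suc c * (\<Sum>i\<le>L. q ^ (i * (i + c) + 2 * i) * w i * w (L - i) * w (Suc c + i))"
    by (simp add: sum_distrib_left algebra_simps power_add mult_2_right)
  also have "(\<Sum>i\<le>Suc L. q ^ (i * (i + c) + i) * (W (int i) * W (int L - int i)) * w (c + i)) =
      (\<Sum>i\<le>L. q ^ (i * (i + c) + i) * w i * w (L - i) * w (c + i))"
    by (auto simp: W_def nat_diff_distrib mult.assoc intro!: sum.cong)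
  finally have "(1 - q ^ Suc L) * (\<Sum>i\<le>Suc L. q ^ (i * (i + c)) * w i * w (Suc L - i) * w (c + i))
      = w L * w (Suc L + c)"
    unfolding low s by simp
  also have "\<dots> = (1 - q ^ Suc L) * (w (Suc L) * w (Suc L + c))"
    using w_Suc[of L] by (simp add: mult.assoc)
  finally show ?case by (rule cancel_one_minus_power) simp
qed

text \<open>For \<open>j \<ge> 0\<close> this is \<open>q_vandermonde\<close> with
  \<open>L = N - j\<close> and \<open>c = 2 * j + 1\<close>, shifted by \<open>n = i + j\<close>;
  for \<open>j > N\<close> both sides are zero. Both sides are invariant under
  \<open>j \<mapsto> - 1 - j\<close>, which covers negative \<open>j\<close>. It is the inner sum of
  Bailey's lemma.\<close>

lemma q_vandermonde_int:
  "(\<Sum>n\<le>N. q ^ (n\<^sup>2 + n) * w (N - n) * (W (int n - j) * W (int n + 1 + j))) =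
    qpow q (j\<^sup>2 + j) * (W (int N - j) * W (int N + 1 + j))"
proof -
  have nonneg: "(\<Sum>n\<le>N. q ^ (n\<^sup>2 + n) * w (N - n) * (W (int n - int d) * W (int n + 1 + int d))) =
    qpow q ((int d)\<^sup>2 + int d) * (W (int N - int d) * W (int N + 1 + int d))" for d
  proof (cases "d \<le> N")
    case True
    have "(\<Sum>n\<le>N. q ^ (n\<^sup>2 + n) * w (N - n) * (W (int n - int d) * W (int n + 1 + int d))) =
      (\<Sum>n\<in>{d..N}. q ^ (n\<^sup>2 + n) * w (N - n) * (W (int n - int d) * W (int n + 1 + int d)))"
      by (rule sum.mono_neutral_right) auto
    also have "\<dots> = (\<Sum>i\<le>N - d. q ^ (d\<^sup>2 + d) *
        (q ^ (i * (i + (2 * d + 1))) * w i * w (N - d - i) * w (2 * d + 1 + i)))"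
    proof (rule sum.reindex_bij_witness[of _ "\<lambda>i. i + d" "\<lambda>n. n - d"])
      fix n assume "n \<in> {d..N}"
      then have n: "n = d + (n - d)" and N: "N - d - (n - d) = N - n" by auto
      have "int n - int d = int (n - d)" "int n + 1 + int d = int (2 * d + 1 + (n - d))"
        using \<open>n \<in> {d..N}\<close> by auto
      then have WW: "W (int n - int d) * W (int n + 1 + int d) = w (n - d) * w (2 * d + 1 + (n - d))"
        by (simp only: W_of_nat)
      \<comment> \<open>With i = n - d this is (d+i)^2 + (d+i) = d^2 + d + i(i+2d+1); only the
        occurrences of \<open>n\<close> outside \<open>n - d\<close> are rewritten.\<close>
      have "d\<^sup>2 + d + (n - d) * (n - d + (2 * d + 1)) = n\<^sup>2 + n"
        by (subst (3 4) n) (simp add: power2_eq_square algebra_simps)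
      then have P: "q ^ (n\<^sup>2 + n) = q ^ (d\<^sup>2 + d) * q ^ ((n - d) * (n - d + (2 * d + 1)))"
        by (simp only: power_add[symmetric])
      show "q ^ (d\<^sup>2 + d) * (q ^ ((n - d) * (n - d + (2 * d + 1))) * w (n - d) *
          w (N - d - (n - d)) * w (2 * d + 1 + (n - d))) =
        q ^ (n\<^sup>2 + n) * w (N - n) * (W (int n - int d) * W (int n + 1 + int d))"
        unfolding WW N P by (simp only: mult_ac)
    qed (use True in auto)
    also have "\<dots> = q ^ (d\<^sup>2 + d) * (w (N - d) * w (N - d + (2 * d + 1)))"
      by (simp only: sum_distrib_left[symmetric] q_vandermonde)
    also have "\<dots> = qpow q ((int d)\<^sup>2 + int d) * (W (int N - int d) * W (int N + 1 + int d))"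
    proof -
      have "int N - int d = int (N - d)" "int N + 1 + int d = int (N - d + (2 * d + 1))"
        "(int d)\<^sup>2 + int d = int (d\<^sup>2 + d)"
        using True by (auto simp: of_nat_diff)
      then show ?thesis by (simp only: W_of_nat qpow_of_nat)
    qed
    finally show ?thesis .
  next
    case False
    then show ?thesis by (subst sum.neutral) auto
  qed
  show ?thesis
  proof (cases "j \<ge> 0")
    case True
    then show ?thesis using nonneg[of "nat j"] by simp
  next
    case False
    then have d: "int (nat (- 1 - j)) = - 1 - j" by simp
    have ix: "int n - (- 1 - j) = int n + 1 + j" "int n + 1 + (- 1 - j) = int n - j"
        "(- 1 - j)\<^sup>2 + (- 1 - j) = j\<^sup>2 + j" for n
      by (simp_all add: power2_eq_square algebra_simps)
    show ?thesis
      using nonneg[of "nat (- 1 - j)"] unfolding d ix by (simp only: mult.commute[of "W (_ + 1 + j)"])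
  qed
qed

end

section \<open>The Bailey pair\<close>

lemma abs_le_square_int: "\<bar>r\<bar> \<le> r\<^sup>2" for r :: int
proof -
  have "\<bar>r\<bar> * 1 \<le> \<bar>r\<bar> * \<bar>r\<bar>"
  proof (cases "r = 0")
    case False
    then show ?thesis by (intro mult_left_mono) auto
  qed simp
  then show ?thesis by (simp add: power2_eq_square)
qed

text \<open>This symmetry is the reason for summing over the lopsided interval from -M-1 to M
  throughout.\<close>

lemma sum_symmetric_interval_shift:
  "(\<Sum>r\<in>{- int M - 1..int M}. f (- 1 - r)) = (\<Sum>r\<in>{- int M - 1..int M}. f r)"
  by (rule sum.reindex_bij_witness[of _ "\<lambda>r. - 1 - r" "\<lambda>r. - 1 - r"]) auto

text \<open>The interval is not symmetric about 0, but adding the endpoint \<open>M + 1\<close>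
  makes it so, and the extra terms vanish by assumption.\<close>

lemma sum_symmetric_interval_uminus:
  assumes "\<And>r. \<bar>r\<bar> > int M \<Longrightarrow> f r = 0"
  shows "(\<Sum>r\<in>{- int M - 1..int M}. f (- r)) = (\<Sum>r\<in>{- int M - 1..int M}. f r)"
proof -
  have "(\<Sum>r\<in>{- int M - 1..int M}. f (- r)) = (\<Sum>r\<in>{- int M - 1..int M + 1}. f (- r))"
    by (rule sum.mono_neutral_left) (auto intro!: assms)
  also have "\<dots> = (\<Sum>r\<in>{- int M - 1..int M + 1}. f r)"
    by (rule sum.reindex_bij_witness[of _ uminus uminus]) auto
  also have "\<dots> = (\<Sum>r\<in>{- int M - 1..int M}. f r)"
    by (rule sum.mono_neutral_right) (auto intro!: assms)
  finally show ?thesis .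
qed

context qfact_inverse
begin

text \<open>\<open>pascal1\<close> on both products gives the right-hand side plus the correction
  \<open>g (- r) - g r\<close>. The sum of this is zero because \<open>g\<close> vanishes for
  \<bar>r\<bar> > M.\<close>

lemma bailey_sum_even_Suc:
  assumes "m < M"
  shows "(1 - q ^ (2 * m + 2)) * (\<Sum>r\<in>{- int M - 1..int M}.
      qpow q (6 * r\<^sup>2 + r) * (W (int (Suc m) - 3 * r) * W (int (Suc m) + 3 * r))
      - qpow q (6 * r\<^sup>2 + 5 * r + 1) * (W (int (Suc m) - 1 - 3 * r) * W (int (Suc m) + 1 + 3 * r))) =
    (\<Sum>r\<in>{- int M - 1..int M}.
      qpow q (6 * r\<^sup>2 + r) * (W (int m - 3 * r) * W (int m + 1 + 3 * r))
      - qpow q (6 * r\<^sup>2 + 5 * r + 1) * (W (int m - 1 - 3 * r) * W (int m + 2 + 3 * r)))"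
proof -
  define g where "g r = qpow q (6 * r\<^sup>2 + 2 * r + int m + 1) * (W (int m - 3 * r) * W (int m + 1 + 3 * r))" for r
  have step: "(1 - q ^ (2 * m + 2)) *
      (qpow q (6 * r\<^sup>2 + r) * (W (int (Suc m) - 3 * r) * W (int (Suc m) + 3 * r))
        - qpow q (6 * r\<^sup>2 + 5 * r + 1) * (W (int (Suc m) - 1 - 3 * r) * W (int (Suc m) + 1 + 3 * r))) =
      (qpow q (6 * r\<^sup>2 + r) * (W (int m - 3 * r) * W (int m + 1 + 3 * r))
        - qpow q (6 * r\<^sup>2 + 5 * r + 1) * (W (int m - 1 - 3 * r) * W (int m + 2 + 3 * r)))
      + (g (- r) - g r)" for r
  proof -
    have nonneg: "6 * r\<^sup>2 + r \<ge> 0" "6 * r\<^sup>2 + 5 * r + 1 \<ge> 0"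
      using abs_le_square_int[of r] by linarith+
    have ix: "int (Suc m) - 3 * r = int m + 1 - 3 * r" "int (Suc m) + 3 * r = int m + 1 + 3 * r"
        "int (Suc m) - 1 - 3 * r = int m - 3 * r" "int (Suc m) + 1 + 3 * r = int m + 2 + 3 * r"
      by auto
    have 1: "(1 - q ^ (2 * m + 2)) * (W (int (Suc m) - 3 * r) * W (int (Suc m) + 3 * r)) =
        W (int m - 3 * r) * W (int m + 1 + 3 * r)
        + qpow q (int (Suc m) - 3 * r) * (W (int (Suc m) - 3 * r) * W (int m + 3 * r))"
      unfolding ix by (rule pascal1) auto
    have 2: "(1 - q ^ (2 * m + 2)) * (W (int (Suc m) - 1 - 3 * r) * W (int (Suc m) + 1 + 3 * r)) =
        W (int m - 1 - 3 * r) * W (int m + 2 + 3 * r)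
        + qpow q (int (Suc m) - 1 - 3 * r) * (W (int (Suc m) - 1 - 3 * r) * W (int m + 1 + 3 * r))"
      unfolding ix by (rule pascal1) auto
    have g1: "qpow q (6 * r\<^sup>2 + r) * (qpow q (int (Suc m) - 3 * r) * (W (int (Suc m) - 3 * r) * W (int m + 3 * r)))
        = g (- r)"
      by (subst qpow_W_W[OF nonneg(1)]) (simp add: g_def algebra_simps)
    have g2: "qpow q (6 * r\<^sup>2 + 5 * r + 1) * (qpow q (int (Suc m) - 1 - 3 * r) * (W (int (Suc m) - 1 - 3 * r) * W (int m + 1 + 3 * r)))
        = g r"
      by (subst qpow_W_W[OF nonneg(2)]) (simp add: g_def algebra_simps)
    have "c * (x * a - y * b) = x * (c * a) - y * (c * b)" for a b c x y :: 'a
      by (simp add: algebra_simps)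
    then show ?thesis
      by (simp only: 1 2 distrib_left g1 g2 add_diff_add)
  qed
  have "(\<Sum>r\<in>{- int M - 1..int M}. g (- r)) = (\<Sum>r\<in>{- int M - 1..int M}. g r)"
  proof (rule sum_symmetric_interval_uminus)
    fix r :: int assume "\<bar>r\<bar> > int M"
    then have "int m - 3 * r < 0 \<or> int m + 1 + 3 * r < 0" using assms by linarith
    then show "g r = 0" by (auto simp: g_def)
  qed
  then show ?thesis
    unfolding sum_distrib_left step by (simp add: sum.distrib sum_subtractf)
qed

text \<open>Here \<open>pascal2\<close> is used on both products, and the correction
  \<open>g r - g (- 1 - r)\<close> sums to zero because the interval is invariant under
  \<open>r \<mapsto> - 1 - r\<close>.\<close>

lemma bailey_sum_odd:
  "(1 - q ^ (2 * m + 1)) * (\<Sum>r\<in>{- int M - 1..int M}.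
      qpow q (6 * r\<^sup>2 + r) * (W (int m - 3 * r) * W (int m + 1 + 3 * r))
      - qpow q (6 * r\<^sup>2 + 5 * r + 1) * (W (int m - 1 - 3 * r) * W (int m + 2 + 3 * r))) =
    (\<Sum>r\<in>{- int M - 1..int M}.
      qpow q (6 * r\<^sup>2 + r) * (W (int m - 3 * r) * W (int m + 3 * r))
      - qpow q (6 * r\<^sup>2 + 5 * r + 1) * (W (int m - 1 - 3 * r) * W (int m + 1 + 3 * r)))"
proof -
  define g where "g r = qpow q (6 * r\<^sup>2 + 4 * r + int m + 1) * (W (int m + 1 + 3 * r) * W (int m - 1 - 3 * r))" for r
  have step: "(1 - q ^ (2 * m + 1)) *
      (qpow q (6 * r\<^sup>2 + r) * (W (int m - 3 * r) * W (int m + 1 + 3 * r))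
        - qpow q (6 * r\<^sup>2 + 5 * r + 1) * (W (int m - 1 - 3 * r) * W (int m + 2 + 3 * r))) =
      (qpow q (6 * r\<^sup>2 + r) * (W (int m - 3 * r) * W (int m + 3 * r))
        - qpow q (6 * r\<^sup>2 + 5 * r + 1) * (W (int m - 1 - 3 * r) * W (int m + 1 + 3 * r)))
      + (g r - g (- 1 - r))" for r
  proof -
    have nonneg: "6 * r\<^sup>2 + r \<ge> 0" "6 * r\<^sup>2 + 5 * r + 1 \<ge> 0"
      using abs_le_square_int[of r] by linarith+
    have 1: "(1 - q ^ (2 * m + 1)) * (W (int m - 3 * r) * W (int m + 1 + 3 * r)) =
        W (int m - 3 * r) * W (int m + 3 * r)
        + qpow q (int m + 1 + 3 * r) * (W (int m + 1 + 3 * r) * W (int m - 1 - 3 * r))"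
      by (rule pascal2) auto
    have 2: "(1 - q ^ (2 * m + 1)) * (W (int m - 1 - 3 * r) * W (int m + 2 + 3 * r)) =
        W (int m - 1 - 3 * r) * W (int m + 1 + 3 * r)
        + qpow q (int m + 2 + 3 * r) * (W (int m + 2 + 3 * r) * W (int m - 2 - 3 * r))"
      by (rule pascal2) auto
    have g1: "qpow q (6 * r\<^sup>2 + r) * (qpow q (int m + 1 + 3 * r) * (W (int m + 1 + 3 * r) * W (int m - 1 - 3 * r)))
        = g r"
      by (subst qpow_W_W[OF nonneg(1)]) (simp add: g_def algebra_simps)
    have g2: "qpow q (6 * r\<^sup>2 + 5 * r + 1) * (qpow q (int m + 2 + 3 * r) * (W (int m + 2 + 3 * r) * W (int m - 2 - 3 * r)))
        = g (- 1 - r)"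
      by (subst qpow_W_W[OF nonneg(2)]) (simp add: g_def algebra_simps power2_eq_square)
    have "c * (x * a - y * b) = x * (c * a) - y * (c * b)" for a b c x y :: 'a
      by (simp add: algebra_simps)
    then show ?thesis
      by (simp only: 1 2 distrib_left g1 g2 add_diff_add)
  qed
  show ?thesis
    unfolding sum_distrib_left step
    by (simp add: sum.distrib sum_subtractf sum_symmetric_interval_shift)
qed

lemma bailey_sum_even:
  assumes "n \<le> M"
  shows "(\<Sum>r\<in>{- int M - 1..int M}.
      qpow q (6 * r\<^sup>2 + r) * (W (int n - 3 * r) * W (int n + 3 * r))
      - qpow q (6 * r\<^sup>2 + 5 * r + 1) * (W (int n - 1 - 3 * r) * W (int n + 1 + 3 * r))) = w (2 * n)"
  (is "?S n = _")
  using assms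
proof (induction n)
  case 0
  \<comment> \<open>In each product the two indices add to 0, so both must be 0 for it to survive.
    This happens for \<open>r = 0\<close> in the first product and never in the second, as 1 + 3r is
    not 0.\<close>
  have "?S 0 = (\<Sum>r\<in>{0}. qpow q (6 * r\<^sup>2 + r) * (W (int 0 - 3 * r) * W (int 0 + 3 * r))
      - qpow q (6 * r\<^sup>2 + 5 * r + 1) * (W (int 0 - 1 - 3 * r) * W (int 0 + 1 + 3 * r)))"
    by (rule sum.mono_neutral_right) (auto simp: W_def)
  then show ?case using W_of_nat[of 0] by (simp add: qpow_def)
next
  case (Suc m)
  \<comment> \<open>An even and an odd step together lower the index by one;
    \<open>w (2 * m)\<close> satisfies the same recurrence.\<close>
  have "(1 - q ^ (2 * m + 1)) * ((1 - q ^ (2 * m + 2)) * ?S (Suc m)) = ?S m"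
    using Suc.prems by (simp only: bailey_sum_even_Suc[of m M] bailey_sum_odd Suc_le_eq)
  also have "\<dots> = (1 - q ^ (2 * m + 1)) * ((1 - q ^ (2 * m + 2)) * w (2 * Suc m))"
    using Suc w_Suc[of "2 * m"] w_Suc[of "2 * m + 1"] by simp
  finally have "(1 - q ^ (2 * m + 2)) * ?S (Suc m) = (1 - q ^ (2 * m + 2)) * w (2 * Suc m)"
    by (rule cancel_one_minus_power) simp
  then show ?case by (rule cancel_one_minus_power) simp
qed

text \<open>\<open>pascal1\<close> on the first product and \<open>pascal2\<close> on the second
  create the same term, which cancels in the difference. What is left is q^n times the summand of
  \<open>bailey_sum_even\<close>, with its second half reflected by
  \<open>r \<mapsto> - 1 - r\<close>.\<close>

lemma bailey_pair:
  assumes "n \<le> M"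
  shows "(\<Sum>r\<in>{- int M - 1..int M}.
      qpow q (6 * r\<^sup>2 + 4 * r) * (W (int n - 3 * r) * W (int n + 1 + 3 * r)
        - W (int n - 1 - 3 * r) * W (int n + 2 + 3 * r))) = q ^ n * w (2 * n + 1)"
  (is "?T = _")
proof -
  define f where "f r = qpow q (6 * r\<^sup>2 + r) * (W (int n - 3 * r) * W (int n + 3 * r))" for r
  define g where "g r = qpow q (6 * r\<^sup>2 + 5 * r + 1) * (W (int n - 1 - 3 * r) * W (int n + 1 + 3 * r))" for r
  have step: "(1 - q ^ (2 * n + 1)) *
      (qpow q (6 * r\<^sup>2 + 4 * r) * (W (int n - 3 * r) * W (int n + 1 + 3 * r)
        - W (int n - 1 - 3 * r) * W (int n + 2 + 3 * r))) = q ^ n * (f r - g (- 1 - r))" for r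
  proof -
    \<comment> \<open>The bound \<bar>r\<bar> \<le> r^2 alone is too weak for
      \<open>6 * r\<^sup>2 + 7 * r + 2 \<ge> 0\<close>, so it is also used at
      \<open>r + 1\<close>.\<close>
    have "\<bar>r + 1\<bar> \<le> r\<^sup>2 + 2 * r + 1"
      using abs_le_square_int[of "r + 1"] by (simp add: power2_sum)
    then have nonneg: "6 * r\<^sup>2 + 4 * r \<ge> 0" "6 * r\<^sup>2 + r \<ge> 0" "6 * r\<^sup>2 + 7 * r + 2 \<ge> 0"
      using abs_le_square_int[of r] by linarith+
    have 1: "(1 - q ^ (2 * n + 1)) * (W (int n - 3 * r) * W (int n + 1 + 3 * r)) =
        W (int n - 1 - 3 * r) * W (int n + 1 + 3 * r)
        + qpow q (int n - 3 * r) * (W (int n - 3 * r) * W (int n + 3 * r))"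
      by (rule pascal1) auto
    have 2: "(1 - q ^ (2 * n + 1)) * (W (int n - 1 - 3 * r) * W (int n + 2 + 3 * r)) =
        W (int n - 1 - 3 * r) * W (int n + 1 + 3 * r)
        + qpow q (int n + 2 + 3 * r) * (W (int n + 2 + 3 * r) * W (int n - 2 - 3 * r))"
      by (rule pascal2) auto
    have fr: "qpow q (6 * r\<^sup>2 + 4 * r) * (qpow q (int n - 3 * r) * (W (int n - 3 * r) * W (int n + 3 * r)))
        = q ^ n * f r"
    proof -
      have "q ^ n * f r = (qpow q (int n) * qpow q (6 * r\<^sup>2 + r)) * (W (int n - 3 * r) * W (int n + 3 * r))"
        by (simp add: f_def mult.assoc)
      also have "\<dots> = qpow q (6 * r\<^sup>2 + 4 * r + (int n - 3 * r)) * (W (int n - 3 * r) * W (int n + 3 * r))"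
        using nonneg by (subst qpow_add) (simp_all add: algebra_simps)
      finally show ?thesis
        by (simp only: qpow_W_W[OF nonneg(1)])
    qed
    have gr: "qpow q (6 * r\<^sup>2 + 4 * r) * (qpow q (int n + 2 + 3 * r) * (W (int n + 2 + 3 * r) * W (int n - 2 - 3 * r)))
        = q ^ n * g (- 1 - r)"
    proof -
      have "g (- 1 - r) = qpow q (6 * r\<^sup>2 + 7 * r + 2) * (W (int n + 2 + 3 * r) * W (int n - 2 - 3 * r))"
        by (simp add: g_def algebra_simps power2_eq_square)
      then have "q ^ n * g (- 1 - r) =
          (qpow q (int n) * qpow q (6 * r\<^sup>2 + 7 * r + 2)) * (W (int n + 2 + 3 * r) * W (int n - 2 - 3 * r))"
        by (simp add: mult.assoc)
      also have "\<dots> = qpow q (6 * r\<^sup>2 + 4 * r + (int n + 2 + 3 * r)) * (W (int n + 2 + 3 * r) * W (int n - 2 - 3 * r))"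
        using nonneg by (subst qpow_add) (simp_all add: algebra_simps)
      finally show ?thesis
        by (simp only: qpow_W_W[OF nonneg(1)])
    qed
    have "c * (x * (a - b)) = x * (c * a) - x * (c * b)" for a b c x :: 'a
      by (simp add: algebra_simps)
    then show ?thesis
      by (simp only: 1 2 distrib_left fr gr add_diff_cancel_left right_diff_distrib[of "q ^ n"])
  qed
  have "(1 - q ^ (2 * n + 1)) * ?T = q ^ n * (\<Sum>r\<in>{- int M - 1..int M}. f r - g (- 1 - r))"
    unfolding sum_distrib_left step by simp
  also have "(\<Sum>r\<in>{- int M - 1..int M}. f r - g (- 1 - r)) = (\<Sum>r\<in>{- int M - 1..int M}. f r - g r)"
    by (simp add: sum_subtractf sum_symmetric_interval_shift)
  also have "\<dots> = w (2 * n)"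
    unfolding f_def g_def by (rule bailey_sum_even[OF assms])
  also have "q ^ n * w (2 * n) = (1 - q ^ (2 * n + 1)) * (q ^ n * w (2 * n + 1))"
    using w_Suc[of "2 * n"] by (simp only: mult_ac Suc_eq_plus1)
  finally show ?thesis by (rule cancel_one_minus_power) simp
qed

section \<open>The identity between finite sums\<close>

text \<open>As N grows, \<open>w (N - n)\<close> and each \<open>W\<close> tend to
  1/(q;q)_\<infinity>. The left side acquires one such factor and the right side two, which explains
  the prefactor of the theorem.\<close>

lemma finite_identity:
  "(\<Sum>n\<le>N. q ^ (n\<^sup>2 + 2 * n) * w (2 * n + 1) * w (N - n)) =
    (\<Sum>k\<in>{- int N - 1..int N}.
      qpow q (15 * k\<^sup>2 - 7 * k) * (W (int N + 3 * k) * W (int N + 1 - 3 * k))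
      - qpow q (15 * k\<^sup>2 + 13 * k + 2) * (W (int N - 1 - 3 * k) * W (int N + 2 + 3 * k)))"
proof -
  let ?I = "{- int N - 1..int N}"
  let ?v = "\<lambda>n. q ^ (n\<^sup>2 + n) * w (N - n)"
  let ?A = "\<lambda>n r. W (int n - 3 * r) * W (int n + 1 + 3 * r)"
  let ?B = "\<lambda>n r. W (int n - 1 - 3 * r) * W (int n + 2 + 3 * r)"
  have A: "(\<Sum>n\<le>N. ?v n * ?A n r) = qpow q (9 * r\<^sup>2 + 3 * r) * ?A N r" for r
    using q_vandermonde_int[of N "3 * r"] by (simp add: algebra_simps)
  have B: "(\<Sum>n\<le>N. ?v n * ?B n r) = qpow q (9 * r\<^sup>2 + 9 * r + 2) * ?B N r" for r
  proof -
    have ix: "int n - (3 * r + 1) = int n - 1 - 3 * r" "int n + 1 + (3 * r + 1) = int n + 2 + 3 * r"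
      "(3 * r + 1)\<^sup>2 + (3 * r + 1) = 9 * r\<^sup>2 + 9 * r + 2" for n
      by (simp_all add: power2_eq_square algebra_simps)
    show ?thesis using q_vandermonde_int[of N "3 * r + 1"] unfolding ix .
  qed
  have "(\<Sum>n\<le>N. q ^ (n\<^sup>2 + 2 * n) * w (2 * n + 1) * w (N - n)) =
      (\<Sum>n\<le>N. ?v n * (q ^ n * w (2 * n + 1)))"
    by (simp add: power_add algebra_simps mult_2_right)
  \<comment> \<open>\<open>bailey_pair\<close> is used with \<open>M = N\<close> for every
    \<open>n \<le> N\<close>, so the range of \<open>r\<close> does not depend on \<open>n\<close>
    and the sums can be swapped.\<close>
  also have "\<dots> = (\<Sum>n\<le>N. ?v n * (\<Sum>r\<in>?I. qpow q (6 * r\<^sup>2 + 4 * r) * (?A n r - ?B n r)))"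
    by (intro sum.cong refl) (simp add: bailey_pair)
  also have "\<dots> = (\<Sum>r\<in>?I. \<Sum>n\<le>N. ?v n * (qpow q (6 * r\<^sup>2 + 4 * r) * (?A n r - ?B n r)))"
    unfolding sum_distrib_left by (rule sum.swap)
  also have "\<dots> = (\<Sum>r\<in>?I. qpow q (6 * r\<^sup>2 + 4 * r) * ((\<Sum>n\<le>N. ?v n * ?A n r) - (\<Sum>n\<le>N. ?v n * ?B n r)))"
    by (simp only: right_diff_distrib sum_subtractf sum_distrib_left mult.left_commute)
  also have "\<dots> = (\<Sum>r\<in>?I. qpow q (15 * r\<^sup>2 + 7 * r) * ?A N r - qpow q (15 * r\<^sup>2 + 13 * r + 2) * ?B N r)"
  proof (rule sum.cong[OF refl])
    fix r :: int
    have nonneg: "6 * r\<^sup>2 + 4 * r \<ge> 0" "9 * r\<^sup>2 + 3 * r \<ge> 0" "9 * r\<^sup>2 + 9 * r + 2 \<ge> 0"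
      using abs_le_square_int[of r] by linarith+
    have "qpow q (6 * r\<^sup>2 + 4 * r) * qpow q (9 * r\<^sup>2 + 3 * r) = qpow q (15 * r\<^sup>2 + 7 * r)"
      "qpow q (6 * r\<^sup>2 + 4 * r) * qpow q (9 * r\<^sup>2 + 9 * r + 2) = qpow q (15 * r\<^sup>2 + 13 * r + 2)"
      using nonneg by (simp_all add: qpow_add algebra_simps)
    then show "qpow q (6 * r\<^sup>2 + 4 * r) * ((\<Sum>n\<le>N. ?v n * ?A n r) - (\<Sum>n\<le>N. ?v n * ?B n r)) =
        qpow q (15 * r\<^sup>2 + 7 * r) * ?A N r - qpow q (15 * r\<^sup>2 + 13 * r + 2) * ?B N r"
      unfolding A B by (simp add: right_diff_distrib flip: mult.assoc)
  qed
  also have "\<dots> = (\<Sum>r\<in>?I. qpow q (15 * r\<^sup>2 + 7 * r) * ?A N r)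
      - (\<Sum>r\<in>?I. qpow q (15 * r\<^sup>2 + 13 * r + 2) * ?B N r)"
    by (rule sum_subtractf)
  \<comment> \<open>Only the first sum is reflected, turning 15r^2 + 7r into the exponent 15k^2 - 7k
    of the theorem.\<close>
  also have "(\<Sum>r\<in>?I. qpow q (15 * r\<^sup>2 + 7 * r) * ?A N r) =
      (\<Sum>r\<in>?I. qpow q (15 * (- r)\<^sup>2 + 7 * (- r)) * ?A N (- r))"
  proof (rule sum_symmetric_interval_uminus[symmetric])
    fix r :: int assume "\<bar>r\<bar> > int N"
    then have "int N - 3 * r < 0 \<or> int N + 1 + 3 * r < 0" by linarith
    then show "qpow q (15 * r\<^sup>2 + 7 * r) * ?A N r = 0" by auto
  qed
  finally show ?thesis by (simp add: sum_subtractf)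
qed

end

subsection \<open>The limit for complex numbers\<close>

lemma qpow_eq_power_int:
  fixes q :: "'a::{comm_ring_1,inverse}"
  shows "e \<ge> 0 \<Longrightarrow> q powi e = qpow q e"
  by (simp add: power_int_def qpow_def)

text \<open>\<open>int_encode\<close> interleaves the two signs, so the code of k is at most
  2\<bar>k\<bar>. With \<open>theta_exponents_ge\<close> the n-th theta term is then dominated by a
  multiple of \<bar>q\<bar>^n.\<close>

lemma abs_int_decode_ge: "int n \<le> 2 * \<bar>int_decode n\<bar>"
proof -
  have "n = int_encode (int_decode n)" by simp
  then show ?thesis
    unfolding int_encode_def sum_encode_def by (auto split: if_splits)
qed

lemma theta_exponents_ge:
  fixes k :: int
  shows "2 * \<bar>k\<bar> \<le> 15 * k\<^sup>2 - 7 * k" "2 * \<bar>k\<bar> \<le> 15 * k\<^sup>2 + 13 * k + 2"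
  using abs_le_square_int[of k] by linarith+

lemma qfact_LIMSEQ:
  fixes q :: complex
  assumes "norm q < 1"
  shows "qfact q \<longlonglongrightarrow> qfact_inf q" "qfact_inf q \<noteq> 0" "qfact q n \<noteq> 0"
proof -
  have nz: "1 - q ^ Suc j \<noteq> 0" for j
  proof
    assume "1 - q ^ Suc j = 0"
    then have "norm q ^ Suc j = 1"
      by (metis norm_one norm_power right_minus_eq)
    moreover have "norm q ^ Suc j \<le> norm q"
      using assms power_decreasing[of 1 "Suc j" "norm q"] by simp
    ultimately show False using assms by simp
  qed
  have "summable (\<lambda>j. norm q ^ Suc j)"
    using assms by (subst summable_Suc_iff) (simp add: summable_geometric)
  then have "abs_convergent_prod (\<lambda>j. 1 - q ^ Suc j)"
    by (intro summable_imp_abs_convergent_prod) (simp add: norm_power norm_mult)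
  then have conv: "convergent_prod (\<lambda>j. 1 - q ^ Suc j)"
    by (rule abs_convergent_prod_imp_convergent_prod)
  have eq: "qfact q n = (\<Prod>j<n. 1 - q ^ Suc j)" for n
    unfolding qfact_def by (rule prod.reindex_bij_witness[of _ Suc "\<lambda>j. j - 1"]) auto
  have "(\<lambda>n. \<Prod>j\<le>n. 1 - q ^ Suc j) \<longlonglongrightarrow> qfact_inf q"
    unfolding qfact_inf_def by (rule convergent_prod_LIMSEQ[OF conv])
  then show "qfact q \<longlonglongrightarrow> qfact_inf q"
    by (simp add: LIMSEQ_lessThan_iff_atMost eq[abs_def])
  show "qfact_inf q \<noteq> 0"
    unfolding qfact_inf_def using conv nz by (rule prodinf_nonzero)
  show "qfact q n \<noteq> 0"
    unfolding eq using nz by simp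
qed

text \<open>The offset \<open>nat (- c)\<close> skips the finitely many indices where
  \<open>N + c\<close> is negative.\<close>

lemma W_LIMSEQ:
  fixes q :: "'a :: {comm_ring_1, topological_space}"
  assumes "qfact_inverse q w" and "w \<longlonglongrightarrow> L"
  shows "(\<lambda>N. qfact_inverse.W w (int N + c)) \<longlonglongrightarrow> L"
proof (rule LIMSEQ_offset[where k = "nat (- c)"])
  interpret qfact_inverse q w by fact
  have "W (int (N + nat (- c)) + c) = w (N + nat c)" for N
    by (cases "c \<ge> 0") (auto simp: W_def nat_add_distrib)
  then show "(\<lambda>N. W (int (N + nat (- c)) + c)) \<longlonglongrightarrow> L"
    using LIMSEQ_ignore_initial_segment[OF assms(2)] by simp
qed

lemma identity_complex:
  fixes q :: complex
  assumes q: "norm q < 1"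
  shows "summable (\<lambda>n. q ^ (n\<^sup>2 + 2 * n) / qfact q (2 * n + 1))"
    and "(\<lambda>k::int. q powi (15 * k\<^sup>2 - 7 * k) - q powi (15 * k\<^sup>2 + 13 * k + 2)) summable_on UNIV"
    and "(\<Sum>n. q ^ (n\<^sup>2 + 2 * n) / qfact q (2 * n + 1)) =
          1 / qfact_inf q *
            (\<Sum>\<^sub>\<infinity>k::int. q powi (15 * k\<^sup>2 - 7 * k) - q powi (15 * k\<^sup>2 + 13 * k + 2))"
proof -
  define w where "w n = inverse (qfact q n)" for n
  define L where "L = inverse (qfact_inf q)"
  interpret qfact_inverse q w
    by unfold_locales (simp add: w_def qfact_LIMSEQ(3)[OF q])
  have wL: "w \<longlonglongrightarrow> L"
    unfolding w_def L_def by (intro tendsto_inverse qfact_LIMSEQ q)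
  then have "Bseq w" by (rule convergent_imp_Bseq[OF convergentI])
  \<comment> \<open>A bound on \<open>w\<close> that is uniform in the index yields majorants
    independent of \<open>N\<close>, as Tannery's theorem requires.\<close>
  then obtain C where C: "C > 0" "\<And>n. norm (w n) \<le> C"
    unfolding Bseq_def by auto
  have W_le: "norm (W k) \<le> C" for k
    using C by (simp add: W_def)
  have WW_le: "norm (W j * W k) \<le> C * C" for j k
    using C(1) by (auto simp: norm_mult intro!: mult_mono W_le)
  have summable_bound: "summable (\<lambda>n. norm q ^ n * D)" for D
    using q by (intro summable_mult2 summable_geometric) simp

  \<comment> \<open>With \<open>W (int N - int n)\<close> the terms for \<open>n > N\<close> vanish;
    with truncated subtraction \<open>w (N - n)\<close> would be 1 there.\<close>
  define a where "a n N = q ^ (n\<^sup>2 + 2 * n) * w (2 * n + 1) * W (int N - int n)" for n N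
  define g where "g k = qpow q (15 * k\<^sup>2 - 7 * k) - qpow q (15 * k\<^sup>2 + 13 * k + 2)" for k
  \<comment> \<open>The bilateral sum is enumerated by \<open>int_decode\<close>, so that Tannery's
    theorem for series over \<open>nat\<close> applies.\<close>
  define b where "b n N = (let k = int_decode n in
      qpow q (15 * k\<^sup>2 - 7 * k) * (W (int N + 3 * k) * W (int N + 1 - 3 * k))
      - qpow q (15 * k\<^sup>2 + 13 * k + 2) * (W (int N - 1 - 3 * k) * W (int N + 2 + 3 * k)))" for n N
  have norm_a: "norm (a n N) \<le> norm q ^ n * (C * C)" for n N
    unfolding a_def using q C(1)
    by (auto simp: norm_mult norm_power mult.assoc power_decreasing intro!: mult_mono W_le C)
  have norm_qpow: "norm (qpow q e) \<le> norm q ^ n" if "e \<ge> 2 * \<bar>int_decode n\<bar>" for e n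
    unfolding qpow_def norm_power using q abs_int_decode_ge[of n] that
    by (intro power_decreasing) auto
  have norm_b: "norm (b n N) \<le> norm q ^ n * (2 * (C * C))" for n N
  proof -
    have "norm (b n N) \<le> norm q ^ n * (C * C) + norm q ^ n * (C * C)"
      unfolding b_def Let_def
      by (rule order_trans[OF norm_triangle_ineq4], unfold norm_mult[of "qpow q _"],
          intro add_mono mult_mono WW_le norm_qpow theta_exponents_ge) auto
    then show ?thesis by (simp add: algebra_simps)
  qed
  have norm_g: "norm (g (int_decode n)) \<le> norm q ^ n * 2" for n
    unfolding g_def using norm_qpow[OF theta_exponents_ge(1), of n] norm_qpow[OF theta_exponents_ge(2), of n]
    by (intro order_trans[OF norm_triangle_ineq4]) simp

  have lim_a: "(\<lambda>N. a n N) \<longlonglongrightarrow> q ^ (n\<^sup>2 + 2 * n) * w (2 * n + 1) * L" for n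
    unfolding a_def using W_LIMSEQ[OF qfact_inverse_axioms wL, of "- int n"] by (intro tendsto_mult tendsto_const) simp
  have lim_b: "(\<lambda>N. b n N) \<longlonglongrightarrow> g (int_decode n) * (L * L)" for n
    unfolding b_def g_def Let_def left_diff_distrib add_diff_eq diff_diff_eq
    using W_LIMSEQ[OF qfact_inverse_axioms wL, of "3 * int_decode n"] W_LIMSEQ[OF qfact_inverse_axioms wL, of "1 - 3 * int_decode n"]
      W_LIMSEQ[OF qfact_inverse_axioms wL, of "- 1 - 3 * int_decode n"] W_LIMSEQ[OF qfact_inverse_axioms wL, of "2 + 3 * int_decode n"]
    by (intro tendsto_diff tendsto_mult tendsto_const) (simp_all add: algebra_simps)

  have "(\<lambda>N. \<Sum>n. a n N) \<longlonglongrightarrow> (\<Sum>n. q ^ (n\<^sup>2 + 2 * n) * w (2 * n + 1) * L)"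
    using tannerys_theorem[OF lim_a always_eventually summable_bound[of "C * C"] sequentially_bot] norm_a
    by auto
  moreover have "(\<lambda>N. \<Sum>n. b n N) \<longlonglongrightarrow> (\<Sum>n. g (int_decode n) * (L * L))"
    using tannerys_theorem[OF lim_b always_eventually summable_bound[of "2 * (C * C)"] sequentially_bot] norm_b
    by auto
  moreover have "(\<Sum>n. a n N) = (\<Sum>n. b n N)" for N
  proof -
    have "(\<Sum>n. a n N) = (\<Sum>n\<le>N. a n N)"
      by (rule suminf_finite) (auto simp: a_def)
    also have "\<dots> = (\<Sum>n\<le>N. q ^ (n\<^sup>2 + 2 * n) * w (2 * n + 1) * w (N - n))"
    proof (intro sum.cong refl)
      fix n assume "n \<in> {..N}"
      then have "int N - int n = int (N - n)" by simp
      then show "a n N = q ^ (n\<^sup>2 + 2 * n) * w (2 * n + 1) * w (N - n)"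
        by (simp only: a_def W_of_nat)
    qed
    also have "\<dots> = (\<Sum>k\<in>{- int N - 1..int N}. b (int_encode k) N)"
      unfolding finite_identity by (simp add: b_def)
    also have "\<dots> = (\<Sum>n\<in>int_encode ` {- int N - 1..int N}. b n N)"
      by (simp add: sum.reindex[OF inj_int_encode])
    also have "\<dots> = (\<Sum>n. b n N)"
    proof (rule suminf_finite[symmetric])
      fix n assume "n \<notin> int_encode ` {- int N - 1..int N}"
      then have "int_decode n \<notin> {- int N - 1..int N}"
        by (metis image_eqI int_decode_inverse)
      \<comment> \<open>In both cases each of the two products has a factor \<open>W\<close> with
        negative index.\<close>
      then have "int_decode n < - int N - 1 \<or> int_decode n > int N" by auto
      then show "b n N = 0" by (auto simp: b_def Let_def)
    qed simp
    finally show ?thesis .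
  qed
  ultimately have eq: "(\<Sum>n. q ^ (n\<^sup>2 + 2 * n) * w (2 * n + 1) * L) = (\<Sum>n. g (int_decode n) * (L * L))"
    by (simp add: LIMSEQ_unique)

  have norm_summand: "norm (q ^ (n\<^sup>2 + 2 * n) / qfact q (2 * n + 1)) \<le> norm q ^ n * C" for n
    using q C(1) C(2)[of "2 * n + 1"]
    by (auto simp: divide_inverse norm_mult norm_power w_def power_decreasing simp del: norm_inverse intro!: mult_mono)
  show summable: "summable (\<lambda>n. q ^ (n\<^sup>2 + 2 * n) / qfact q (2 * n + 1))"
    by (rule summable_comparison_test'[OF summable_bound norm_summand])
  \<comment> \<open>Absolute convergence turns the ordered series into an unordered sum, which
    transfers to the integers along the bijection \<open>int_decode\<close>.\<close>
  have "summable (\<lambda>n. norm (g (int_decode n)))"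
    by (rule summable_comparison_test'[OF summable_bound]) (use norm_g in auto)
  then have sg: "summable (\<lambda>n. g (int_decode n))"
      and "((\<lambda>n. g (int_decode n)) has_sum (\<Sum>n. g (int_decode n))) UNIV"
    by (auto intro!: norm_summable_imp_has_sum summable_sums dest: summable_norm_cancel)
  then have "(g has_sum (\<Sum>n. g (int_decode n))) UNIV"
    using has_sum_reindex_bij_betw[OF bij_int_decode] by blast
  moreover have "g = (\<lambda>k. q powi (15 * k\<^sup>2 - 7 * k) - q powi (15 * k\<^sup>2 + 13 * k + 2))"
    by (intro ext) (simp only: g_def qpow_eq_power_int exponent1_nonneg exponent2_nonneg)
  ultimately have has_sum: "((\<lambda>k. q powi (15 * k\<^sup>2 - 7 * k) - q powi (15 * k\<^sup>2 + 13 * k + 2))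
      has_sum (\<Sum>n. g (int_decode n))) UNIV"
    by simp
  then show "(\<lambda>k::int. q powi (15 * k\<^sup>2 - 7 * k) - q powi (15 * k\<^sup>2 + 13 * k + 2)) summable_on UNIV"
    by (rule has_sum_imp_summable)
  have "(\<Sum>n. q ^ (n\<^sup>2 + 2 * n) / qfact q (2 * n + 1)) * L = (\<Sum>n. g (int_decode n)) * (L * L)"
    using eq suminf_mult2[OF summable, of L] suminf_mult2[OF sg, of "L * L"]
    by (simp add: w_def divide_inverse)
  then have "(\<Sum>n. q ^ (n\<^sup>2 + 2 * n) / qfact q (2 * n + 1)) = L * (\<Sum>n. g (int_decode n))"
    using qfact_LIMSEQ(2)[OF q] by (simp add: L_def)
  then show "(\<Sum>n. q ^ (n\<^sup>2 + 2 * n) / qfact q (2 * n + 1)) =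
          1 / qfact_inf q *
            (\<Sum>\<^sub>\<infinity>k::int. q powi (15 * k\<^sup>2 - 7 * k) - q powi (15 * k\<^sup>2 + 13 * k + 2))"
    using infsumI[OF has_sum] by (simp add: L_def inverse_eq_divide)
qed

subsection \<open>The limit for formal power series\<close>

text \<open>Congruence modulo X^(m+1). The limit \<open>N \<rightarrow> \<infinity>\<close> becomes
  a choice of sufficiently large \<open>N\<close> for each precision \<open>m\<close>.\<close>

definition fps_agree :: "nat \<Rightarrow> 'a::comm_ring_1 fps \<Rightarrow> 'a fps \<Rightarrow> bool" where
  "fps_agree m f g \<longleftrightarrow> (\<forall>i\<le>m. fps_nth f i = fps_nth g i)"

lemma fps_agreeI: "(\<And>i. i \<le> m \<Longrightarrow> fps_nth f i = fps_nth g i) \<Longrightarrow> fps_agree m f g"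
  by (simp add: fps_agree_def)

lemma fps_agree_refl [simp]: "fps_agree m f f"
  by (simp add: fps_agree_def)

lemma fps_agree_sym: "fps_agree m f g \<Longrightarrow> fps_agree m g f"
  by (simp add: fps_agree_def)

lemma fps_agree_trans [trans]: "fps_agree m f g \<Longrightarrow> fps_agree m g h \<Longrightarrow> fps_agree m f h"
  by (simp add: fps_agree_def)

lemma fps_agree_diff: "fps_agree m f g \<Longrightarrow> fps_agree m f' g' \<Longrightarrow> fps_agree m (f - f') (g - g')"
  by (simp add: fps_agree_def)

lemma fps_agree_mult: "fps_agree m f g \<Longrightarrow> fps_agree m f' g' \<Longrightarrow> fps_agree m (f * f') (g * g')"
  by (auto simp: fps_agree_def fps_mult_nth intro!: sum.cong)

lemma fps_agree_sum: "(\<And>x. x \<in> A \<Longrightarrow> fps_agree m (f x) (g x)) \<Longrightarrow> fps_agree m (sum f A) (sum g A)"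
  by (auto simp: fps_agree_def fps_sum_nth intro!: sum.cong)

lemma fps_eqI_agree: "(\<And>m. fps_agree m f g) \<Longrightarrow> f = g"
  by (auto simp: fps_agree_def fps_eq_iff)

lemma fps_agree_qpow_0: "e > int m \<Longrightarrow> fps_agree m (qpow fps_X e) 0"
  by (rule fps_agreeI) (simp add: qpow_def)

text \<open>The assumption says that X^n divides \<open>f n\<close>, so only the terms with
  \<open>n \<le> i\<close> contribute to the coefficient of X^i.\<close>

lemma fps_sums_and_agree:
  fixes f :: "nat \<Rightarrow> 'a::comm_ring_1 fps"
  assumes "\<And>m n. m < n \<Longrightarrow> fps_agree m (f n) 0"
  shows "summable f" and "fps_agree m (suminf f) (\<Sum>n\<le>m. f n)"
proof -
  define S where "S = Abs_fps (\<lambda>i. \<Sum>n\<le>i. fps_nth (f n) i)"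
  have *: "(\<Sum>n\<in>A. fps_nth (f n) i) = fps_nth S i" if "finite A" "{..i} \<subseteq> A" for i A
  proof -
    have "(\<Sum>n\<in>A. fps_nth (f n) i) = (\<Sum>n\<in>{..i}. fps_nth (f n) i)"
      using that assms[of i] by (intro sum.mono_neutral_right) (auto simp: fps_agree_def)
    then show ?thesis by (simp add: S_def)
  qed
  have "f sums S"
    unfolding sums_def
  proof (rule tendsto_fpsI)
    fix i
    show "eventually (\<lambda>N. fps_nth (\<Sum>n<N. f n) i = fps_nth S i) sequentially"
      using eventually_gt_at_top[of i]
      by eventually_elim (unfold fps_sum_nth, rule *, auto)
  qed
  then show "summable f" and "fps_agree m (suminf f) (\<Sum>n\<le>m. f n)"
    by (auto simp: sums_iff fps_agree_def fps_sum_nth * dest: sums_summable)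
qed

text \<open>The bilateral analogue: X^\<bar>k\<bar> divides \<open>f k\<close>, so each coefficient
  receives finitely many contributions.\<close>

lemma fps_has_sum_int_and_agree:
  fixes f :: "int \<Rightarrow> 'a::comm_ring_1 fps"
  assumes "\<And>m k. int m < \<bar>k\<bar> \<Longrightarrow> fps_agree m (f k) 0"
  shows "f summable_on UNIV" and "fps_agree m (infsum f UNIV) (\<Sum>k\<in>{- int m..int m}. f k)"
proof -
  have sub: "{k. fps_nth (f k) i \<noteq> 0} \<subseteq> {- int i..int i}" for i
  proof
    fix k assume "k \<in> {k. fps_nth (f k) i \<noteq> 0}"
    then have "\<not> fps_agree i (f k) 0" by (auto simp: fps_agree_def)
    then have "\<bar>k\<bar> \<le> int i" using assms[of i k] by linarith
    then show "k \<in> {- int i..int i}" by auto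
  qed
  define S where "S = Abs_fps (\<lambda>i. \<Sum>k | fps_nth (f k) i \<noteq> 0. fps_nth (f k) i)"
  have S: "(f has_sum S) UNIV"
    by (rule has_sum_fpsI) (auto simp: S_def intro: finite_subset[OF sub])
  then show "f summable_on UNIV"
    by (rule has_sum_imp_summable)
  have "fps_agree m S (\<Sum>k\<in>{- int m..int m}. f k)"
  proof (rule fps_agreeI)
    fix i assume "i \<le> m"
    then have "{k. fps_nth (f k) i \<noteq> 0} \<subseteq> {- int m..int m}"
      using sub[of i] by (rule_tac order_trans) auto
    then show "fps_nth S i = fps_nth (\<Sum>k\<in>{- int m..int m}. f k) i"
      unfolding fps_sum_nth S_def fps_nth_Abs_fps by (intro sum.mono_neutral_left) auto
  qed
  then show "fps_agree m (infsum f UNIV) (\<Sum>k\<in>{- int m..int m}. f k)"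
    using infsumI[OF S] by simp
qed

text \<open>Passing from n to n+1 subtracts a multiple of X^(n+1), which does not affect
  coefficients up to \<open>m \<le> n\<close>.\<close>

lemma fps_agree_qfact:
  fixes m n :: nat
  assumes "m \<le> n"
  shows "fps_agree m (qfact fps_X n) (qfact (fps_X :: 'a::comm_ring_1 fps) m)"
  using assms
proof (induction n rule: dec_induct)
  case (step n)
  have "fps_agree m (qfact fps_X (Suc n)) (qfact (fps_X :: 'a fps) n)"
    using step.hyps by (intro fps_agreeI) (simp add: qfact_Suc left_diff_distrib fps_X_power_mult_nth
        del: power_Suc)
  then show ?case using step.IH by (rule fps_agree_trans)
qed simp

lemma qfact_inf_fps:
  fixes m n :: nat
  shows "m \<le> n \<Longrightarrow> fps_agree m (qfact fps_X n) (qfact_inf (fps_X :: 'a::idom fps))"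
    and "fps_nth (qfact_inf (fps_X :: 'a fps)) 0 = 1"
proof -
  \<comment> \<open>The coefficient of X^i is stable from the i-th partial product on, so the
    diagonal gives the limit.\<close>
  define P where "P = Abs_fps (\<lambda>i. fps_nth (qfact (fps_X :: 'a fps) i) i)"
  have P: "fps_agree m (qfact fps_X n) P" if "m \<le> n" for m n
    using that fps_agree_qfact[where 'a = 'a]
    by (auto simp: P_def fps_agree_def)
  have P0: "fps_nth P 0 = 1"
    by (simp add: P_def qfact_def)
  \<comment> \<open>The summand \<open>i + 0\<close> matches \<open>raw_has_prod\<close> with
    starting index 0; that notion also demands a non-zero limit, whence \<open>P0\<close>.\<close>
  have eq: "(\<Prod>i\<le>n. 1 - fps_X ^ Suc (i + 0)) = qfact (fps_X :: 'a fps) (Suc n)" for n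
    unfolding qfact_def by (rule prod.reindex_bij_witness[of _ "\<lambda>j. j - 1" Suc]) auto
  have "(\<lambda>n. qfact (fps_X :: 'a fps) (Suc n)) \<longlonglongrightarrow> P"
  proof (rule tendsto_fpsI)
    fix i
    show "eventually (\<lambda>n. fps_nth (qfact fps_X (Suc n)) i = fps_nth P i) sequentially"
      using eventually_ge_at_top[of i]
      by eventually_elim (use P[of i "Suc _"] in \<open>auto simp: fps_agree_def\<close>)
  qed
  moreover have "P \<noteq> 0" using P0 by auto
  ultimately have "(\<lambda>i. 1 - (fps_X :: 'a fps) ^ Suc i) has_prod P"
    unfolding has_prod_def raw_has_prod_def eq by blast
  then have "qfact_inf (fps_X :: 'a fps) = P"
    unfolding qfact_inf_def by (rule has_prod_unique[symmetric])
  then show "m \<le> n \<Longrightarrow> fps_agree m (qfact fps_X n) (qfact_inf (fps_X :: 'a fps))"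
    and "fps_nth (qfact_inf (fps_X :: 'a fps)) 0 = 1"
    using P P0 by simp_all
qed

lemma identity_fps:
  fixes X :: "'a::field fps"
  defines "X \<equiv> fps_X"
  shows "summable (\<lambda>n. X ^ (n\<^sup>2 + 2 * n) / qfact X (2 * n + 1))"
    and "(\<lambda>k::int. X powi (15 * k\<^sup>2 - 7 * k) - X powi (15 * k\<^sup>2 + 13 * k + 2)) summable_on UNIV"
    and "(\<Sum>n. X ^ (n\<^sup>2 + 2 * n) / qfact X (2 * n + 1)) =
          1 / qfact_inf X *
            (\<Sum>\<^sub>\<infinity>k::int. X powi (15 * k\<^sup>2 - 7 * k) - X powi (15 * k\<^sup>2 + 13 * k + 2))"
proof -
  define w where "w n = inverse (qfact X n)" for n
  define L where "L = inverse (qfact_inf X)"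
  have qfact_0: "fps_nth (qfact X n) 0 = 1" for n
    using qfact_inf_fps(1)[of 0 n, where 'a = 'a] qfact_inf_fps(2)[where 'a = 'a] by (simp add: X_def fps_agree_def)
  have qfact_inf_0: "fps_nth (qfact_inf X) 0 = 1"
    unfolding X_def by (rule qfact_inf_fps)
  interpret qfact_inverse X w
    by unfold_locales (simp add: w_def inverse_mult_eq_1 qfact_0)
  have L: "L * qfact_inf X = 1"
    by (simp add: L_def inverse_mult_eq_1 qfact_inf_0)
  have w_L: "fps_agree m (w n) L" if "m \<le> n" for m n
  proof -
    \<comment> \<open>The left side is \<open>w n\<close>, and replacing the infinite product by
      (X;X)_n modulo X^(m+1) leaves \<open>L\<close>.\<close>
    have "fps_agree m (w n * (L * qfact_inf X)) (w n * (L * qfact X n))"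
      unfolding X_def using that
      by (intro fps_agree_mult fps_agree_refl fps_agree_sym[OF qfact_inf_fps(1)])
    moreover have "w n * (L * qfact X n) = L"
      using w_qfact[of n] by (simp add: mult.left_commute)
    ultimately show ?thesis by (simp add: L)
  qed
  have W_L: "fps_agree m (W j) L" if "int m \<le> j" for m j
    using that w_L[of m "nat j"] by (simp add: W_def le_nat_iff)

  define f where "f n = X ^ (n\<^sup>2 + 2 * n) * w (2 * n + 1)" for n
  define g where "g k = qpow X (15 * k\<^sup>2 - 7 * k) - qpow X (15 * k\<^sup>2 + 13 * k + 2)" for k
  have f_0: "fps_agree m (f n) 0" if "m < n" for m n
  proof -
    have "m < n\<^sup>2 + 2 * n" using that by simp
    then show ?thesis
      by (intro fps_agreeI) (simp add: f_def X_def fps_X_power_mult_nth)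
  qed
  have theta_0: "fps_agree m (qpow X (15 * k\<^sup>2 - 7 * k)) 0"
    "fps_agree m (qpow X (15 * k\<^sup>2 + 13 * k + 2)) 0" if "int m < \<bar>k\<bar>" for m k
    unfolding X_def using that theta_exponents_ge[of k] by (auto intro!: fps_agree_qpow_0)
  have g_0: "fps_agree m (g k) 0" if "int m < \<bar>k\<bar>" for m k
    using fps_agree_diff[OF theta_0[OF that]] by (simp add: g_def)
  have f_eq: "f = (\<lambda>n. X ^ (n\<^sup>2 + 2 * n) / qfact X (2 * n + 1))"
    by (simp add: f_def w_def fun_eq_iff fps_divide_unit qfact_0)
  have g_eq: "g = (\<lambda>k. X powi (15 * k\<^sup>2 - 7 * k) - X powi (15 * k\<^sup>2 + 13 * k + 2))"
    by (intro ext) (simp only: g_def qpow_eq_power_int exponent1_nonneg exponent2_nonneg)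
  show "summable (\<lambda>n. X ^ (n\<^sup>2 + 2 * n) / qfact X (2 * n + 1))"
    using fps_sums_and_agree(1)[of f] f_0 by (simp add: f_eq)
  show "(\<lambda>k::int. X powi (15 * k\<^sup>2 - 7 * k) - X powi (15 * k\<^sup>2 + 13 * k + 2)) summable_on UNIV"
    using fps_has_sum_int_and_agree(1)[of g] g_0 by (simp add: g_eq)

  have eq: "suminf f * L = infsum g UNIV * (L * L)"
  proof (rule fps_eqI_agree)
    fix m :: nat
    \<comment> \<open>Large enough that every index of \<open>W\<close> is at least \<open>m\<close>
      when \<bar>k\<bar> \<le> m; the tightest case is \<open>N - 1 - 3 * k\<close> at
      \<open>k = m\<close>. Also \<open>N - n \<ge> m\<close> for \<open>n \<le> m\<close>.\<close>
    define N where "N = 4 * m + 1"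
    have "fps_agree m (suminf f * L) ((\<Sum>n\<le>m. f n) * L)"
      by (intro fps_agree_mult fps_agree_refl fps_sums_and_agree(2) f_0)
    also have "(\<Sum>n\<le>m. f n) * L = (\<Sum>n\<le>N. if n \<le> m then f n * L else 0)"
      unfolding sum_distrib_right by (rule sum.mono_neutral_cong_left) (auto simp: N_def)
    also have "fps_agree m \<dots> (\<Sum>n\<le>N. f n * w (N - n))"
    proof (rule fps_agree_sum)
      fix n assume "n \<in> {..N}"
      show "fps_agree m (if n \<le> m then f n * L else 0) (f n * w (N - n))"
      proof (cases "n \<le> m")
        case True
        then have "fps_agree m (w (N - n)) L" by (intro w_L) (simp add: N_def)
        then show ?thesis using True by (auto intro: fps_agree_mult fps_agree_sym)
      next
        case False
        then show ?thesis using fps_agree_mult[OF f_0[of m n] fps_agree_refl, of "w (N - n)"]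
          by (auto intro: fps_agree_sym)
      qed
    qed
    also have "(\<Sum>n\<le>N. f n * w (N - n)) = (\<Sum>k\<in>{- int N - 1..int N}.
        qpow X (15 * k\<^sup>2 - 7 * k) * (W (int N + 3 * k) * W (int N + 1 - 3 * k))
        - qpow X (15 * k\<^sup>2 + 13 * k + 2) * (W (int N - 1 - 3 * k) * W (int N + 2 + 3 * k)))"
      unfolding f_def by (rule finite_identity)
    also have "fps_agree m \<dots> (\<Sum>k\<in>{- int N - 1..int N}. if \<bar>k\<bar> \<le> int m then g k * (L * L) else 0)"
    proof (rule fps_agree_sum)
      fix k
      let ?t = "qpow X (15 * k\<^sup>2 - 7 * k) * (W (int N + 3 * k) * W (int N + 1 - 3 * k))
        - qpow X (15 * k\<^sup>2 + 13 * k + 2) * (W (int N - 1 - 3 * k) * W (int N + 2 + 3 * k))"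
      show "fps_agree m ?t (if \<bar>k\<bar> \<le> int m then g k * (L * L) else 0)"
      proof (cases "\<bar>k\<bar> \<le> int m")
        case True
        have "fps_agree m ?t (qpow X (15 * k\<^sup>2 - 7 * k) * (L * L) - qpow X (15 * k\<^sup>2 + 13 * k + 2) * (L * L))"
          by (intro fps_agree_diff fps_agree_mult fps_agree_refl W_L) (use True in \<open>auto simp: N_def\<close>)
        then show ?thesis using True by (simp add: g_def left_diff_distrib)
      next
        case False
        then have "int m < \<bar>k\<bar>" by simp
        have "fps_agree m ?t (0 * (W (int N + 3 * k) * W (int N + 1 - 3 * k))
            - 0 * (W (int N - 1 - 3 * k) * W (int N + 2 + 3 * k)))"
          by (intro fps_agree_diff fps_agree_mult fps_agree_refl theta_0 \<open>int m < \<bar>k\<bar>\<close>)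
        then show ?thesis using False by simp
      qed
    qed
    also have "(\<Sum>k\<in>{- int N - 1..int N}. if \<bar>k\<bar> \<le> int m then g k * (L * L) else 0) =
        (\<Sum>k\<in>{- int m..int m}. g k) * (L * L)"
      unfolding sum_distrib_right by (rule sum.mono_neutral_cong_right) (auto simp: N_def)
    also have "fps_agree m \<dots> (infsum g UNIV * (L * L))"
      by (intro fps_agree_mult fps_agree_refl fps_agree_sym[OF fps_has_sum_int_and_agree(2)] g_0)
    finally show "fps_agree m (suminf f * L) (infsum g UNIV * (L * L))" .
  qed
  \<comment> \<open>Multiplying by the infinite product removes one of the two factors
    \<open>L\<close> on the right.\<close>
  have "suminf f = suminf f * L * qfact_inf X"
    by (simp add: mult.assoc L)
  also have "\<dots> = L * infsum g UNIV * (L * qfact_inf X)"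
    unfolding eq by (simp only: mult_ac)
  also have "\<dots> = L * infsum g UNIV"
    by (simp add: L)
  also have "L = 1 / qfact_inf X"
    by (simp add: L_def fps_divide_unit qfact_inf_0)
  finally show "(\<Sum>n. X ^ (n\<^sup>2 + 2 * n) / qfact X (2 * n + 1)) =
      1 / qfact_inf X * (\<Sum>\<^sub>\<infinity>k::int. X powi (15 * k\<^sup>2 - 7 * k) - X powi (15 * k\<^sup>2 + 13 * k + 2))"
    by (simp only: f_eq g_eq)
qed

theorem corollary5p4:
  shows
    "(let X = (fps_X :: complex fps) in
        summable (\<lambda>n. X ^ (n\<^sup>2 + 2 * n) / qfact X (2 * n + 1)) \<and>
        (\<lambda>k::int. X powi (15 * k\<^sup>2 - 7 * k) - X powi (15 * k\<^sup>2 + 13 * k + 2)) summable_on UNIV \<and>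
        (\<Sum>n. X ^ (n\<^sup>2 + 2 * n) / qfact X (2 * n + 1)) =
          1 / qfact_inf X *
            (\<Sum>\<^sub>\<infinity>k::int. X powi (15 * k\<^sup>2 - 7 * k) - X powi (15 * k\<^sup>2 + 13 * k + 2)))
     \<and>
     (\<forall>q::complex. norm q < 1 \<longrightarrow>
        summable (\<lambda>n. q ^ (n\<^sup>2 + 2 * n) / qfact q (2 * n + 1)) \<and>
        (\<lambda>k::int. q powi (15 * k\<^sup>2 - 7 * k) - q powi (15 * k\<^sup>2 + 13 * k + 2)) summable_on UNIV \<and>
        (\<Sum>n. q ^ (n\<^sup>2 + 2 * n) / qfact q (2 * n + 1)) =
          1 / qfact_inf q *
            (\<Sum>\<^sub>\<infinity>k::int. q powi (15 * k\<^sup>2 - 7 * k) - q powi (15 * k\<^sup>2 + 13 * k + 2)))"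
  using identity_fps[where 'a = complex] identity_complex by (simp only: Let_def simp_thms) blast

end
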